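(* Let $q$ be a prime power, let $t \ge 1$, and let $f(x)=\sum_{i=0}^{t} b_i x^i \in \mathbb{F}_q[x]$ be a monic polynomial of degree $t$ with non-zero constant term $b_0 \neq 0$. Let $\Gamma_f=\{\beta_1,\ldots,\beta_\gamma\}$ be the set of $\beta\in\mathbb{F}_q$ with $f(\beta)\neq 0$ (so $\gamma=|\Gamma_f|$). Then the matrix $M(f)$ constructed from $f$ (as described in the context) is an $OOA(q^t;t,\gamma+1,t,q)$, i.e. a $q^t\times (\gamma+1)t$ array over $\mathbb{F}_q$, with columns partitioned into the $\gamma+1$ blocks $Bl(\infty), Bl(\beta_1),\ldots,Bl(\beta_\gamma)$ of $t$ columns each, in which every left-justified set of $t$ columns is covered.
   Context: Streams: $G(f)$ denotes the set of sequences $\mathbf{s}=(\mathbf{s}_n)_{n\in\mathbb{Z}}$ over $\mathbb{F}_q$ satisfying $\sum_{i=0}^{t} b_i \mathbf{s}_{n+i}=0$ for all $n\in\mathbb{Z}$ (since $b_0\ne0$ the recurrence can be run backwards, each stream is determined by $(\mathbf{s}_0,\ldots,\mathbf{s}_{t-1})\in\mathbb{F}_q^t$, so $|G(f)|=q^t$, and every stream is periodic). $L$ is the left-shift operator, $(L\mathbf{s})_n=\mathbf{s}_{n+1}$; for $g\in\mathbb{F}_q[x]$, $g(L)$ acts on $G(f)$ in the obvious way (using scalar multiplication $(\beta\mathbf{s})_n=\beta\mathbf{s}_n$ and addition). For $\beta\in\Gamma_f$ there is $g\in\mathbb{F}_q[x]$ with $g(x)(x-\beta)\equiv 1 \pmod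 f$, and $(L-\beta)^{-1}:=g(L)$ is a well-defined map on $G(f)$ inverse to $L-\beta$. Construction of $M(f)$: The orbits of $L$ (sets $\{\mathbf{s},L\mathbf{s},\ldots,L^{\rho-1}\mathbf{s}\}$ with $\rho$ the period of $\mathbf{s}$) partition $G(f)$ into orbits $C_1,\ldots,C_k$; all streams in $C_i$ have the same period $\rho_i$ (so $\sum_i \rho_i=q^t$). For each $i$ choose a stream $\mathbf{a}^{(i)}\in C_i$ (the base). For $\beta\in\Gamma_f$, let $M(i,\beta)$ be the $\rho_i\times t$ matrix whose $j$-th column ($1\le j\le t$) consists of the entries with indices $0,1,\ldots,\rho_i-1$ of the stream $(L-\beta)^{-j}\mathbf{a}^{(i)}$. Let $M(i,\infty)$ be the $\rho_i\times t$ matrix whose $j$-th column consists of the entries with indices $0,\ldots,\rho_i-1$ of $L^{j-1}\mathbf{a}^{(i)}$. $M(f)$ is the block matrix whose $i$-th block row ($1\le i\le k$) is $[\,M(i,\infty)\mid M(i,\beta_1)\mid\cdots\mid M(i,\beta_\gamma)\,]$; the block $Bl(\infty)$ consists of the $t$ columns coming from the $M(i,\infty)$, and $Bl(\beta_m)$ of the $t$ columns coming from the $M(i,\beta_m)$, with columns inside each block ordered by $j=1,\ldots,t$. OOA: an $n\times ms$ array over an alphabet of size $v$, with columns labeled $(i,j)$, $1\le i\le m$ (block), $1\le j\le s$ (position in block). A set $\Omega$ of columns is left-justified if $(i,j)\in\Omega$ with $j>1$ implies $(i,j-1)\in\Omega$. A set of $t$ columns is covered if every $t$-tuple over the alphabet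 appears exactly once as a row of the corresponding subarray. An $OOA(n;t,m,s,v)$ (with $n=v^t$) is such an array in which every left-justified set of $t$ columns is covered. *)

theory Defs
  imports "HOL-Number_Theory.Cong" "HOL-Computational_Algebra.Polynomial" "HOL-Library.FuncSet" "HOL-Library.Cardinality"
begin

type_synonym 'a stream = "int \<Rightarrow> 'a"

definition G :: "'a::field poly \<Rightarrow> 'a stream set" where
  "G f = {s. \<forall>n. (\<Sum>i\<le>degree f. coeff f i * s (n + int i)) = 0}"

definition left_shift :: "'a stream \<Rightarrow> 'a stream" where
  "left_shift s = (\<lambda>n. s (n + 1))"

text \<open>The operator \<open>g(L)\<close>, where \<open>L\<close> is the left shift.\<close>

definition poly_shift :: "'a::field poly \<Rightarrow> 'a stream \<Rightarrow> 'a stream" where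
  "poly_shift g s = (\<lambda>n. \<Sum>i\<le>degree g. coeff g i * (left_shift ^^ i) s n)"

definition Gam :: "'a::field poly \<Rightarrow> 'a set" where
  "Gam f = {\<beta>. poly f \<beta> \<noteq> 0}"

text \<open>The operator \<open>(L - \<beta>)\<^sup>-\<^sup>1 = g(L)\<close>, where \<open>g\<close> is an inverse of \<open>x - \<beta>\<close> modulo \<open>f\<close>. Only
  meaningful for \<open>\<beta> \<in> Gam f\<close> and on streams in \<open>G f\<close>, where it does not depend on the choice of \<open>g\<close>.\<close>

definition inv_shift :: "'a::field poly \<Rightarrow> 'a \<Rightarrow> 'a stream \<Rightarrow> 'a stream" where
  "inv_shift f \<beta> = poly_shift (SOME g. [g * [:- \<beta>, 1:] = 1] (mod f))"

text \<open>Only meaningful for periodic streams; if \<open>f\<close> has non-zero constant term and the field is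
  finite, all streams in \<open>G f\<close> are periodic.\<close>

definition period :: "'a stream \<Rightarrow> nat" where
  "period s = (LEAST \<rho>. \<rho> > 0 \<and> (left_shift ^^ \<rho>) s = s)"

definition stream_orbit :: "'a stream \<Rightarrow> 'a stream set" where
  "stream_orbit s = {(left_shift ^^ i) s | i. i < period s}"

text \<open>Arrays whose columns are labeled \<open>(i, j)\<close> with \<open>1 \<le> i \<le> m\<close> and \<open>1 \<le> j \<le> s\<close> are represented as
  lists of rows, each row being an extensional function on the set of column labels.\<close>

type_synonym 'v labeled_array = "(nat \<times> nat \<Rightarrow> 'v) list"

definition col_labels :: "nat \<Rightarrow> nat \<Rightarrow> (nat \<times> nat) set" where
  "col_labels m s = {1..m} \<times> {1..s}"

text \<open>Entry in row \<open>r\<close> (counted from 0) and column \<open>j\<close> (counted from 1) of the matrices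
  \<open>M(i, \<infinity>)\<close> and \<open>M(i, \<beta>)\<close>, where \<open>a\<close> is the base of the \<open>i\<close>-th orbit.\<close>

definition M_infinity :: "'a stream \<Rightarrow> nat \<Rightarrow> nat \<Rightarrow> 'a" where
  "M_infinity a r j = (left_shift ^^ (j - 1)) a (int r)"

definition M_beta :: "'a::field poly \<Rightarrow> 'a \<Rightarrow> 'a stream \<Rightarrow> nat \<Rightarrow> nat \<Rightarrow> 'a" where
  "M_beta f \<beta> a r j = (inv_shift f \<beta> ^^ j) a (int r)"

text \<open>The block row \<open>[M(i, \<infinity>) | M(i, \<beta>\<^sub>1) | \<dots> | M(i, \<beta>\<^sub>\<gamma>)]\<close>: block 1 is \<open>Bl(\<infinity>)\<close>, and block
  \<open>l + 1\<close> is \<open>Bl(\<beta>\<^sub>l)\<close>, with \<open>\<beta>\<^sub>l\<close> being the list element \<open>\<beta>s ! (l - 1)\<close>.\<close>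

definition block_row :: "'a::field poly \<Rightarrow> 'a list \<Rightarrow> 'a stream \<Rightarrow> 'a labeled_array" where
  "block_row f \<beta>s a =
     map (\<lambda>r. \<lambda>(i, j) \<in> col_labels (length \<beta>s + 1) (degree f).
            if i = 1 then M_infinity a r j else M_beta f (\<beta>s ! (i - 2)) a r j)
         [0..<period a]"

definition M :: "'a::field poly \<Rightarrow> 'a list \<Rightarrow> 'a stream list \<Rightarrow> 'a labeled_array" where
  "M f \<beta>s bases = concat (map (block_row f \<beta>s) bases)"

definition left_justified :: "(nat \<times> nat) set \<Rightarrow> bool" where
  "left_justified \<Omega> \<longleftrightarrow> (\<forall>i j. (i, j) \<in> \<Omega> \<and> j > 1 \<longrightarrow> (i, j - 1) \<in> \<Omega>)"

definition covered :: "'v set \<Rightarrow> 'v labeled_array \<Rightarrow> (nat \<times> nat) set \<Rightarrow> bool" where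
  "covered V A \<Omega> \<longleftrightarrow> (\<forall>x \<in> \<Omega> \<rightarrow>\<^sub>E V. \<exists>!r. r < length A \<and> restrict (A ! r) \<Omega> = x)"

text \<open>\<open>A\<close> is an \<open>OOA(n; t, m, s, v)\<close> over the alphabet \<open>V\<close>.\<close>

definition is_OOA ::
  "'v set \<Rightarrow> 'v labeled_array \<Rightarrow> nat \<Rightarrow> nat \<Rightarrow> nat \<Rightarrow> nat \<Rightarrow> nat \<Rightarrow> bool" where
  "is_OOA V A n t m s v \<longleftrightarrow>
     finite V \<and> card V = v \<and> n = v ^ t \<and>
     length A = n \<and> set A \<subseteq> col_labels m s \<rightarrow>\<^sub>E V \<and>
     (\<forall>\<Omega>. \<Omega> \<subseteq> col_labels m s \<and> left_justified \<Omega> \<and> card \<Omega> = t \<longrightarrow> covered V A \<Omega>)"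

end

theory Submission
  imports Defs "HOL-Library.Multiset"
begin

text \<open>By counting, it suffices that two streams whose rows agree on a left-justified set of \<open>t\<close> columns
  are equal. Their difference \<open>s\<close> lies in \<open>G f\<close>. Writing \<open>s = P(L) e\<close>, where \<open>P\<close> is the product of
  the \<open>(x - \<beta>)\<^sup>n\<close> and \<open>n\<close> is the number of columns taken from \<open>Bl(\<beta>)\<close>, the vanishing of \<open>s\<close> in the
  columns says that \<open>h(L) e\<close> vanishes at \<open>0\<close> for \<open>h = x\<^sup>k P\<close> and for \<open>h = P / (x - \<beta>)\<^sup>j\<close>. By partial
  fractions these \<open>h\<close> span the polynomials of degree less than \<open>t\<close>, so \<open>e\<close> has \<open>t\<close> zero initial
  terms and hence is zero.\<close>

section \<open>Polynomials in the shift operator\<close>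

lemma left_shift_pow: "(left_shift ^^ i) s n = s (n + int i)"
  by (induction i arbitrary: n) (simp_all add: left_shift_def algebra_simps)

lemma poly_shift_eq: "poly_shift g s n = (\<Sum>i\<le>degree g. coeff g i * s (n + int i))"
  by (simp add: poly_shift_def left_shift_pow)

lemma poly_shift_0 [simp]: "poly_shift 0 s n = 0"
  by (simp add: poly_shift_eq)

lemma poly_shift_pCons: "poly_shift (pCons a p) s n = a * s n + poly_shift p s (n + 1)"
proof (cases "p = 0")
  case False
  then show ?thesis
    by (simp add: poly_shift_eq sum.atMost_Suc_shift algebra_simps del: sum.atMost_Suc)
qed (simp add: poly_shift_eq)

lemma poly_shift_1 [simp]: "poly_shift 1 s = s"
  by (rule ext) (simp add: poly_shift_eq)

lemma poly_shift_add: "poly_shift (p + q) s n = poly_shift p s n + poly_shift q s n"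
  by (induction p q arbitrary: n rule: poly_induct2)
     (simp_all add: poly_shift_pCons algebra_simps)

lemma poly_shift_smult: "poly_shift (smult c p) s n = c * poly_shift p s n"
  by (induction p arbitrary: n) (simp_all add: poly_shift_pCons algebra_simps)

text \<open>Streams thus become a module over the polynomial ring; as that ring is commutative, all
  operators \<open>poly_shift g\<close> commute.\<close>

lemma poly_shift_mult: "poly_shift (p * q) s = poly_shift p (poly_shift q s)"
proof (rule ext)
  show "poly_shift (p * q) s n = poly_shift p (poly_shift q s) n" for n
    by (induction p arbitrary: n)
       (simp_all add: poly_shift_pCons poly_shift_add poly_shift_smult)
qed

lemma poly_shift_monom: "poly_shift (monom 1 k) s n = s (n + int k)"
  by (induction k arbitrary: n)
     (simp_all add: monom_0 monom_Suc poly_shift_pCons algebra_simps)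

lemma poly_shift_zero_stream: "poly_shift p (\<lambda>_. 0) = (\<lambda>_. 0)"
  by (rule ext) (simp add: poly_shift_eq)

lemma poly_shift_diff_stream:
  "poly_shift p (\<lambda>n. s n - s' n) = (\<lambda>n. poly_shift p s n - poly_shift p s' n)"
  by (rule ext) (simp add: poly_shift_eq algebra_simps sum_subtractf)

lemma poly_shift_left_shift_pow:
  "poly_shift g ((left_shift ^^ r) s) = (left_shift ^^ r) (poly_shift g s)"
  by (rule ext) (simp add: poly_shift_eq left_shift_pow algebra_simps)

section \<open>The module \<open>G f\<close>\<close>

lemma G_iff: "s \<in> G f \<longleftrightarrow> poly_shift f s = (\<lambda>_. 0)"
  by (auto simp: G_def poly_shift_eq fun_eq_iff)

lemma poly_shift_in_G:
  assumes "s \<in> G f"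
  shows "poly_shift g s \<in> G f"
  using assms unfolding G_iff
  by (metis mult.commute poly_shift_mult poly_shift_zero_stream)

lemma left_shift_pow_in_G:
  assumes "s \<in> G f"
  shows "(left_shift ^^ r) s \<in> G f"
  using assms unfolding G_iff poly_shift_left_shift_pow by (simp add: fun_eq_iff left_shift_pow)

lemma G_diff:
  assumes "s \<in> G f" "s' \<in> G f"
  shows "(\<lambda>n. s n - s' n) \<in> G f"
  using assms unfolding G_iff poly_shift_diff_stream by simp

lemma poly_shift_dvd:
  assumes "s \<in> G f" "f dvd p"
  shows "poly_shift p s = (\<lambda>_. 0)"
proof -
  obtain k where "p = k * f" using assms(2) by (metis dvd_def mult.commute)
  then show ?thesis using assms(1) by (simp add: poly_shift_mult G_iff poly_shift_zero_stream)
qed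

text \<open>Multiples of \<open>f\<close> act as zero on \<open>G f\<close>, so the quotient ring
  modulo \<open>f\<close> acts there. Inverses, periods and initial values are all obtained by
  computing in that ring.\<close>

lemma poly_shift_cong:
  assumes "s \<in> G f" "f dvd p - q"
  shows "poly_shift p s = poly_shift q s"
proof
  fix n
  show "poly_shift p s n = poly_shift q s n"
    using poly_shift_dvd[OF assms] poly_shift_add[of "p - q" q s n] by simp
qed

section \<open>Inverting \<open>L - \<beta>\<close> on \<open>G f\<close>\<close>

lemma inverse_linear_mod:
  fixes f :: "'a::field poly"
  assumes "\<beta> \<in> Gam f"
  shows "\<exists>g. [g * [:- \<beta>, 1:] = 1] (mod f)"
proof -
  have ne: "poly f \<beta> \<noteq> 0" using assms by (simp add: Gam_def)
  \<comment> \<open>By the factor theorem, \<open>f - f(\<beta>) = (x - \<beta>) k\<close>. Modulo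
    \<open>f\<close> the right-hand side is the non-zero constant \<open>- f(\<beta>)\<close>, so
    \<open>- k / f(\<beta>)\<close> is the inverse.\<close>
  have "poly (f - [:poly f \<beta>:]) \<beta> = 0" by simp
  then obtain k where k: "f - [:poly f \<beta>:] = [:- \<beta>, 1:] * k"
    unfolding poly_eq_0_iff_dvd by (rule dvdE)
  define c where "c = inverse (poly f \<beta>)"
  have "smult c f - 1 = smult c (f - [:poly f \<beta>:])"
    using ne by (simp add: smult_diff_right c_def one_pCons)
  also have "\<dots> = smult c k * [:- \<beta>, 1:]" unfolding k by (simp only: mult_smult_left mult_smult_right mult.commute)
  finally have e: "smult (- c) k * [:- \<beta>, 1:] - 1 = - smult c f"
    by (simp only: smult_minus_left mult_minus_left) algebra
  have "f dvd smult (- c) k * [:- \<beta>, 1:] - 1"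
    unfolding e by (simp add: dvd_smult)
  then show ?thesis unfolding cong_iff_dvd_diff by blast
qed

text \<open>Names the polynomial chosen inside \<open>inv_shift\<close>. Only its congruence
  property is used, so the arbitrary choice is harmless.\<close>

definition inv_poly :: "'a::field poly \<Rightarrow> 'a \<Rightarrow> 'a poly" where
  "inv_poly f \<beta> = (SOME g. [g * [:- \<beta>, 1:] = 1] (mod f))"

lemma inv_shift_eq: "inv_shift f \<beta> = poly_shift (inv_poly f \<beta>)"
  by (simp add: inv_shift_def inv_poly_def)

lemma inv_poly_dvd:
  assumes "\<beta> \<in> Gam f"
  shows "f dvd inv_poly f \<beta> * [:- \<beta>, 1:] - 1"
  using someI_ex[OF inverse_linear_mod[OF assms]]
  by (simp add: inv_poly_def cong_iff_dvd_diff)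

lemma inv_shift_linear:
  assumes "\<beta> \<in> Gam f" "s \<in> G f"
  shows "inv_shift f \<beta> (poly_shift [:- \<beta>, 1:] s) = s"
    and "poly_shift [:- \<beta>, 1:] (inv_shift f \<beta> s) = s"
  using poly_shift_cong[OF assms(2) inv_poly_dvd[OF assms(1)]]
  by (simp_all only: inv_shift_eq poly_shift_mult[symmetric] mult.commute poly_shift_1)

lemma inv_shift_pow:
  assumes "\<beta> \<in> Gam f" "s \<in> G f"
  shows "(inv_shift f \<beta> ^^ j) (poly_shift ([:- \<beta>, 1:] ^ j) s) = s"
proof (induction j)
  case (Suc j)
  have "(inv_shift f \<beta> ^^ Suc j) (poly_shift ([:- \<beta>, 1:] ^ Suc j) s)
     = (inv_shift f \<beta> ^^ j)
         (inv_shift f \<beta> (poly_shift [:- \<beta>, 1:] (poly_shift ([:- \<beta>, 1:] ^ j) s)))"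
    by (simp add: funpow_swap1 poly_shift_mult[symmetric])
  then show ?case
    using inv_shift_linear(1)[OF assms(1) poly_shift_in_G[OF assms(2)]] Suc by simp
qed simp

text \<open>Both operators are polynomials in the shift. This lets entry \<open>r\<close> of a
  column be read as entry 0 for the base shifted \<open>r\<close> times.\<close>

lemma inv_shift_pow_left_shift:
  "(inv_shift f \<beta> ^^ j) ((left_shift ^^ r) s) = (left_shift ^^ r) ((inv_shift f \<beta> ^^ j) s)"
  by (induction j) (simp_all add: inv_shift_eq poly_shift_left_shift_pow)

lemma inv_shift_pow_diff:
  "(inv_shift f \<beta> ^^ j) (\<lambda>n. s n - s' n)
    = (\<lambda>n. (inv_shift f \<beta> ^^ j) s n - (inv_shift f \<beta> ^^ j) s' n)"
  by (induction j) (simp_all add: inv_shift_eq poly_shift_diff_stream)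

text \<open>Preimages are found one factor at a time: a preimage of \<open>inv_shift f x s\<close>
  under the remaining factors is sent to \<open>s\<close> once \<open>L - x\<close> is applied as
  well.\<close>

lemma poly_shift_prod_linear_surj:
  assumes "set_mset A \<subseteq> Gam f" "s \<in> G f"
  shows "\<exists>e \<in> G f. poly_shift (\<Prod>x\<in>#A. [:- x, 1:]) e = s"
  using assms
proof (induction A arbitrary: s)
  case (add x A)
  have x: "x \<in> Gam f" using add.prems by simp
  have "inv_shift f x s \<in> G f" using add.prems(2) by (simp add: inv_shift_eq poly_shift_in_G)
  then obtain e where "e \<in> G f" "poly_shift (\<Prod>x\<in>#A. [:- x, 1:]) e = inv_shift f x s"
    using add.IH add.prems(1) by auto
  then show ?case
    using inv_shift_linear(2)[OF x add.prems(2)] by (auto simp: poly_shift_mult simp del: mult_pCons_left intro!: bexI[of _ e])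
qed auto

section \<open>Periodicity and the number of streams\<close>

text \<open>A non-zero constant term makes \<open>f\<close> coprime to \<open>x\<close>. Concretely,
  comparing constant coefficients shows that the cofactor is divisible by \<open>x\<close>, and one
  \<open>x\<close> at a time cancels.\<close>

lemma dvd_monom_multD:
  fixes f :: "'a::field poly"
  assumes "coeff f 0 \<noteq> 0" "f dvd monom 1 i * p"
  shows "f dvd p"
  using assms(2)
proof (induction i)
  case (Suc i)
  then obtain k where k: "pCons 0 (monom 1 i * p) = f * k" by (auto simp: dvd_def monom_Suc)
  have "coeff (f * k) 0 = 0" unfolding k[symmetric] by simp
  then have "coeff k 0 = 0" using assms(1) by (simp add: coeff_mult)
  then obtain k' where "k = pCons 0 k'" by (cases k) auto
  then have "monom 1 i * p = f * k'" using k by simp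
  then show ?case using Suc.IH by simp
qed (simp add: monom_0)

lemma finite_degree_less: "finite {p :: 'a::{field, finite} poly. degree p < n}"
proof (rule finite_subset)
  show "{p :: 'a poly. degree p < n} \<subseteq> Poly ` {xs. set xs \<subseteq> UNIV \<and> length xs \<le> n}"
  proof
    fix p :: "'a poly" assume "p \<in> {p. degree p < n}"
    then have "length (coeffs p) \<le> n" by (cases "p = 0") (auto simp: length_coeffs_degree)
    then show "p \<in> Poly ` {xs. set xs \<subseteq> UNIV \<and> length xs \<le> n}"
      by (intro image_eqI[of _ _ "coeffs p"]) auto
  qed
qed (rule finite_imageI, rule finite_lists_length_le, simp)

text \<open>Pigeonhole: there are finitely many residues modulo \<open>f\<close>, so two powers of
  \<open>x\<close> agree, and the smaller one can be cancelled.\<close>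

lemma monom_finite_order:
  fixes f :: "'a::{field, finite} poly"
  assumes "coeff f 0 \<noteq> 0" "degree f \<ge> 1"
  obtains \<rho> where "\<rho> > 0" "f dvd monom 1 \<rho> - 1"
proof -
  have "f \<noteq> 0" using assms by auto
  then have "degree (monom 1 i mod f) < degree f" for i
    using degree_mod_less[of f "monom 1 i"] assms(2) by auto
  then have "range (\<lambda>i. monom 1 i mod f) \<subseteq> {p. degree p < degree f}"
    by (intro image_subsetI) simp
  then have "finite (range (\<lambda>i. monom 1 i mod f))"
    using finite_degree_less finite_subset by blast
  then have "\<not> inj (\<lambda>i. monom (1::'a) i mod f)" using finite_imageD by blast
  then have "\<exists>i j. i < j \<and> monom (1::'a) i mod f = monom 1 j mod f"
    using linorder_inj_onI'[of UNIV "\<lambda>i::nat. monom (1::'a) i mod f"] by blast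
  then obtain i j where "i < j" "monom (1::'a) j mod f = monom 1 i mod f"
    by (elim exE conjE) (simp only:)
  then have "f dvd monom 1 j - monom 1 i" by (simp add: mod_eq_dvd_iff)
  also have "monom 1 j - monom 1 i = monom 1 i * (monom (1::'a) (j - i) - 1)"
    using \<open>i < j\<close> by (simp add: right_diff_distrib mult_monom)
  finally have "f dvd monom 1 (j - i) - 1" using dvd_monom_multD[OF assms(1)] by blast
  then show ?thesis using that[of "j - i"] \<open>i < j\<close> by simp
qed

lemma G_shift_periodic:
  assumes "s \<in> G f" "f dvd monom 1 \<rho> - 1"
  shows "s (n + int \<rho>) = s n"
  using poly_shift_cong[OF assms] poly_shift_monom[of \<rho> s n] by simp

text \<open>At an index \<open>m \<ge> 0\<close> the entry is computed from initial terms by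
  reducing \<open>x^m\<close> modulo \<open>f\<close>. Negative indices are reached by periodicity
  instead of running the recurrence backwards.\<close>

lemma G_eq_zeroI:
  fixes f :: "'a::{field, finite} poly"
  assumes "coeff f 0 \<noteq> 0" "degree f \<ge> 1" "s \<in> G f"
    and init: "\<And>k. k < degree f \<Longrightarrow> s (int k) = 0"
  shows "s = (\<lambda>_. 0)"
proof
  fix n
  obtain \<rho> where \<rho>: "\<rho> > 0" "f dvd monom 1 \<rho> - 1"
    using monom_finite_order[OF assms(1,2)] .
  have nonneg: "s (int m) = 0" for m
  proof -
    let ?h = "monom 1 m mod f"
    have "f \<noteq> 0" using assms by auto
    then have h: "degree ?h < degree f"
      using assms(2) degree_mod_less[of f "monom 1 m"] by auto
    have "s (int m) = poly_shift (monom 1 m) s 0" by (simp add: poly_shift_monom)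
    also have "\<dots> = poly_shift ?h s 0"
      by (subst poly_shift_cong[OF assms(3)]) (simp_all add: minus_mod_eq_mult_div)
    also have "\<dots> = 0"
      unfolding poly_shift_eq using h by (intro sum.neutral) (auto simp: init)
    finally show ?thesis .
  qed
  have per: "s (n + int (k * \<rho>)) = s n" for k
  proof (induction k)
    case (Suc k)
    then show ?case using G_shift_periodic[OF assms(3) \<rho>(2), of "n + int (k * \<rho>)"]
      by (simp add: algebra_simps)
  qed simp
  \<comment> \<open>Adding \<open>\<bar>n\<bar>\<close> full periods moves the index
    \<open>n\<close> into the non-negative range.\<close>
  have "int (nat \<bar>n\<bar> * \<rho>) \<ge> \<bar>n\<bar>" using \<rho>(1) mult_left_mono[of 1 "int \<rho>" "\<bar>n\<bar>"] by simp
  then have "0 \<le> n + int (nat \<bar>n\<bar> * \<rho>)" by linarith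
  then show "s n = 0" using nonneg[of "nat (n + int (nat \<bar>n\<bar> * \<rho>))"] per[of "nat \<bar>n\<bar>"] by simp
qed

text \<open>The stream is \<open>n \<mapsto> \<lambda>(x\<^sup>n mod f)\<close>, where \<open>\<lambda>\<close> is the linear functional with
  \<open>\<lambda>(x\<^sup>j) = c j\<close> for \<open>j < degree f\<close> and negative \<open>n\<close> are reduced modulo the order of \<open>x\<close>.\<close>

lemma G_prescribed_initial:
  fixes f :: "'a::{field, finite} poly"
  assumes "coeff f 0 \<noteq> 0" "degree f \<ge> 1"
  obtains s where "s \<in> G f" "\<And>k. k < degree f \<Longrightarrow> s (int k) = c k"
proof -
  obtain \<rho> where \<rho>: "\<rho> > 0" "f dvd monom 1 \<rho> - 1"
    using monom_finite_order[OF assms] .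
  define lam where "lam p = (\<Sum>j<degree f. coeff (p mod f) j * c j)" for p
  have lam_add: "lam (p + r) = lam p + lam r" for p r
    by (simp add: lam_def poly_mod_add_left algebra_simps sum.distrib)
  have lam_smult: "lam (smult a p) = a * lam p" for a p
    by (simp add: lam_def mod_smult_left sum_distrib_left mult.assoc)
  have lam_0: "lam 0 = 0" by (simp add: lam_def)
  have lam_sum: "lam (\<Sum>i\<in>I. g i) = (\<Sum>i\<in>I. lam (g i))" for g :: "nat \<Rightarrow> 'a poly" and I
    by (induction I rule: infinite_finite_induct) (simp_all add: lam_0 lam_add)
  have lam_cong: "lam p = lam r" if "p mod f = r mod f" for p r
    using that by (simp add: lam_def)
  have red: "monom 1 (m + k * \<rho>) mod f = monom 1 m mod f" for m k
  proof -
    have "(monom 1 \<rho>) mod f = 1 mod f" using \<rho>(2) by (simp add: mod_eq_dvd_iff)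
    then have "monom 1 \<rho> ^ k mod f = 1 ^ k mod f"
      by (metis power_mod)
    then have "monom 1 m * monom 1 \<rho> ^ k mod f = monom 1 m * 1 ^ k mod f"
      by (metis mod_mult_right_eq)
    then show ?thesis by (simp add: monom_power mult_monom mult.commute)
  qed
  define s where "s n = lam (monom 1 (nat (n mod int \<rho>)))" for n
  \<comment> \<open>Only the base index is reduced modulo \<open>\<rho>\<close>, not the sum:
    \<open>lam\<close> depends only on residues modulo \<open>f\<close>, and an exponent linear in
    \<open>i\<close> lets the factor \<open>x^m\<close> be pulled out of the recurrence sum.\<close>
  have s_eq: "s (n + int i) = lam (monom 1 (nat (n mod int \<rho>) + i))" for n i
  proof -
    let ?m = "nat (n mod int \<rho>) + i"
    have "(n + int i) mod int \<rho> = int ?m mod int \<rho>"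
      using \<rho>(1) by (simp add: mod_add_left_eq)
    then have "nat ((n + int i) mod int \<rho>) = ?m mod \<rho>"
      by (simp only: zmod_int[symmetric] nat_int)
    moreover have "lam (monom 1 ?m) = lam (monom 1 (?m mod \<rho>))"
      using red[of "?m mod \<rho>" "?m div \<rho>"] by (intro lam_cong) (simp only: mod_div_mult_eq)
    ultimately show ?thesis by (simp only: s_def)
  qed
  have "(\<Sum>i\<le>degree f. coeff f i * s (n + int i)) = 0" for n
  proof -
    let ?m = "nat (n mod int \<rho>)"
    have "(\<Sum>i\<le>degree f. coeff f i * s (n + int i))
        = lam (\<Sum>i\<le>degree f. smult (coeff f i) (monom 1 (?m + i)))"
      by (simp add: s_eq lam_sum lam_smult)
    also have "(\<Sum>i\<le>degree f. smult (coeff f i) (monom 1 (?m + i)))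
        = monom 1 ?m * (\<Sum>i\<le>degree f. monom (coeff f i) i)"
      by (simp add: sum_distrib_left smult_monom mult_monom)
    also have "\<dots> = monom 1 ?m * f" by (simp add: poly_as_sum_of_monoms)
    also have "lam \<dots> = 0" by (simp add: lam_def)
    finally show ?thesis .
  qed
  then have "s \<in> G f" by (simp add: G_def)
  moreover have "s (int k) = c k" if "k < degree f" for k
  proof -
    have "s (int k) = lam (monom 1 k)" using s_eq[of 0 k] by simp
    also have "\<dots> = (\<Sum>j<degree f. if j = k then c j else 0)"
      using that unfolding lam_def
      by (subst mod_poly_less) (auto simp: degree_monom_eq intro!: sum.cong simp del: sum.delta)
    finally show ?thesis using that by simp
  qed
  ultimately show ?thesis using that by blast
qed

lemma card_G:
  fixes f :: "'a::{field, finite} poly"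
  assumes "coeff f 0 \<noteq> 0" "degree f \<ge> 1"
  shows "card (G f) = CARD('a) ^ degree f"
proof -
  let ?F = "\<lambda>s. \<lambda>k\<in>{..<degree f}. s (int k) :: 'a"
  have "bij_betw ?F (G f) ({..<degree f} \<rightarrow>\<^sub>E UNIV)"
    unfolding bij_betw_def
  proof
    show "inj_on ?F (G f)"
    proof (rule inj_onI)
      fix s s' assume s: "s \<in> G f" "s' \<in> G f" and "?F s = ?F s'"
      then have "s (int k) - s' (int k) = 0" if "k < degree f" for k
        using that by (metis (mono_tags, lifting) lessThan_iff restrict_apply' right_minus_eq)
      then show "s = s'"
        using G_eq_zeroI[OF assms G_diff[OF s]] by (simp add: fun_eq_iff)
    qed
    show "?F ` G f = {..<degree f} \<rightarrow>\<^sub>E UNIV"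
    proof
      show "{..<degree f} \<rightarrow>\<^sub>E UNIV \<subseteq> ?F ` G f"
      proof
        fix c :: "nat \<Rightarrow> 'a" assume c: "c \<in> {..<degree f} \<rightarrow>\<^sub>E UNIV"
        obtain s where s: "s \<in> G f" "\<And>k. k < degree f \<Longrightarrow> s (int k) = c k"
          using G_prescribed_initial[OF assms] by blast
        then have "?F s = c" using c by (intro extensionalityI) (auto simp: PiE_def)
        then show "c \<in> ?F ` G f" using s(1) by blast
      qed
    qed (intro image_subsetI, simp)
  qed
  then show ?thesis by (simp add: bij_betw_same_card card_PiE)
qed

section \<open>Partial fractions\<close>

text \<open>Stating the spanning property for an arbitrary subspace \<open>W\<close> lets the
  induction change \<open>W\<close>. To treat a factor \<open>x - \<beta>\<close>, subtract from
  \<open>h\<close> a member \<open>Q\<close> of the family, scaled so that the difference vanishes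
  at \<open>\<beta>\<close>, and divide the difference by \<open>x - \<beta>\<close>.\<close>

lemma partial_fractions_span:
  fixes W :: "'a::field poly set"
  assumes "0 \<in> W" and "\<And>p r. p \<in> W \<Longrightarrow> r \<in> W \<Longrightarrow> p + r \<in> W"
    and "\<And>c p. p \<in> W \<Longrightarrow> smult c p \<in> W"
    and "\<And>k. k < n \<Longrightarrow> monom 1 k * (\<Prod>x\<in>#A. [:- x, 1:]) \<in> W"
    and "\<And>\<beta> Q j. 0 < j \<Longrightarrow> Q * [:- \<beta>, 1:] ^ j = (\<Prod>x\<in>#A. [:- x, 1:]) \<Longrightarrow> Q \<in> W"
    and "degree h < n + size A"
  shows "h \<in> W"
  using assms
proof (induction A arbitrary: W h)
  case empty
  have "(\<Sum>i\<in>I. monom (coeff h i) i) \<in> W" if "I \<subseteq> {..<n}" for I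
    using finite_subset[OF that finite_lessThan] that
  proof (induction I rule: finite_induct)
    case (insert i I)
    have "smult (coeff h i) (monom 1 i) \<in> W" using empty.prems(3,4) insert.prems by simp
    then show ?case using insert empty.prems(2) by (simp add: smult_monom)
  qed (use empty.prems(1) in simp)
  from this[of "{..degree h}"] show ?case
    using empty.prems(6) by (simp add: poly_as_sum_of_monoms subset_eq)
next
  case (add \<beta> A)
  let ?X = "[:- \<beta>, 1:]" and ?P = "\<lambda>A. \<Prod>x\<in>#A. [:- x, 1 :: 'a:]"
  have ne: "?P B \<noteq> 0" for B by auto
  have deg: "degree (?P B) = size B" for B
    by (induction B) (use ne in \<open>simp_all add: degree_mult_eq del: mult_pCons_left\<close>)
  \<comment> \<open>Removing the full multiplicity of \<open>\<beta>\<close> yields a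
    \<open>Q\<close> in the given family with \<open>Q(\<beta>) \<noteq> 0\<close>.\<close>
  define m where "m = order \<beta> (?P (add_mset \<beta> A))"
  obtain Q where Q: "?P (add_mset \<beta> A) = ?X ^ m * Q" "\<not> ?X dvd Q"
    using order_decomp[OF ne] unfolding m_def by blast
  have "?X dvd ?P (add_mset \<beta> A)" by (simp del: mult_pCons_left)
  then have "m > 0" using Q by (cases m) auto
  have QW: "Q \<in> W" using add.prems(5)[OF \<open>m > 0\<close>, of Q \<beta>] Q(1) by (simp add: mult.commute)
  have "Q \<noteq> 0" using Q(2) by auto
  then have "m + degree Q = Suc (size A)"
    using deg[of "add_mset \<beta> A"] unfolding Q(1) by (simp add: degree_mult_eq degree_power_eq)
  then have degQ: "degree Q < n + Suc (size A)" using \<open>m > 0\<close> by simp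
  have "poly Q \<beta> \<noteq> 0" using Q(2) by (simp add: poly_eq_0_iff_dvd)
  define c where "c = poly h \<beta> / poly Q \<beta>"
  have "poly (h - smult c Q) \<beta> = 0" using \<open>poly Q \<beta> \<noteq> 0\<close> by (simp add: c_def)
  then obtain h' where h': "h - smult c Q = ?X * h'"
    unfolding poly_eq_0_iff_dvd by (rule dvdE)
  have h: "h = ?X * h' + smult c Q" using h' by (simp only: diff_eq_eq)
  have "?X * h' \<in> W"
  proof (cases "h' = 0")
    case False
    \<comment> \<open>Subtracting the multiple of \<open>Q\<close> keeps the degree bound, and
      dividing by \<open>x - \<beta>\<close> then lowers it by one, as the smaller multiset
      requires.\<close>
    have "degree (?X * h') < n + Suc (size A)"
      unfolding h'[symmetric] using degQ add.prems(6)
      by (intro degree_diff_less) (auto intro: le_less_trans[OF degree_smult_le])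
    moreover have "degree (?X * h') = Suc (degree h')"
      using False by (simp add: degree_mult_eq del: mult_pCons_left)
    ultimately have "degree h' < n + size A" by simp
    \<comment> \<open>The new subspace is the preimage of \<open>W\<close> under multiplication by
      \<open>x - \<beta>\<close>. Multiplying a generator for \<open>A\<close> by that factor gives
      a generator for \<open>add_mset \<beta> A\<close>, also when
      \<open>\<gamma> = \<beta>\<close>.\<close>
    have "h' \<in> {p. ?X * p \<in> W}"
    proof (rule add.IH)
      show "p + r \<in> {p. ?X * p \<in> W}" if "p \<in> {p. ?X * p \<in> W}" "r \<in> {p. ?X * p \<in> W}" for p r
        using that add.prems(2)[of "?X * p" "?X * r"] by (simp only: mem_Collect_eq distrib_left)
      show "smult a p \<in> {p. ?X * p \<in> W}" if "p \<in> {p. ?X * p \<in> W}" for a p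
        using that add.prems(3)[of "?X * p" a] by (simp only: mem_Collect_eq mult_smult_right)
      show "monom 1 k * ?P A \<in> {p. ?X * p \<in> W}" if "k < n" for k
        using add.prems(4)[OF that]
        by (simp only: mem_Collect_eq image_mset_add_mset prod_mset.add_mset mult.left_commute)
      show "R \<in> {p. ?X * p \<in> W}" if "0 < j" "R * [:- \<gamma>, 1:] ^ j = ?P A" for \<gamma> R j
        using add.prems(5)[OF that(1), of "?X * R" \<gamma>] that(2)
        by (simp only: mem_Collect_eq image_mset_add_mset prod_mset.add_mset mult.assoc)
    qed (use add.prems(1) \<open>degree h' < n + size A\<close> in simp_all)
    then show ?thesis by simp
  qed (use add.prems(1) in simp)
  then show ?case unfolding h by (intro add.prems(2) add.prems(3) QW)
qed

section \<open>From vanishing columns to the zero stream\<close>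

lemma order_prod_linear:
  "order \<beta> (\<Prod>x\<in>#A. [:- x, 1 :: 'a::field:]) = count A \<beta>"
proof -
  have "proots (\<Prod>x\<in>#A. [:- x, 1 :: 'a:]) = A"
  proof (induction A)
    case (add x A)
    have "[:- x, 1:] \<noteq> 0" "(\<Prod>x\<in>#A. [:- x, 1 :: 'a:]) \<noteq> 0" by auto
    then show ?case using add by (simp add: proots_mult del: mult_pCons_left)
  qed simp
  moreover have "(\<Prod>x\<in>#A. [:- x, 1 :: 'a:]) \<noteq> 0" by auto
  ultimately show ?thesis by (metis count_proots)
qed

text \<open>Here \<open>n\<close> is the number of columns taken from
  \<open>Bl(\<infinity>)\<close>, and the multiset \<open>A\<close> contains each
  \<open>\<beta>\<close> as often as columns are taken from \<open>Bl(\<beta>)\<close>.\<close>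

lemma G_eq_zero_if_columns_zero:
  fixes f :: "'a::{field, finite} poly"
  assumes f: "coeff f 0 \<noteq> 0" "degree f \<ge> 1"
    and "s \<in> G f" and A: "set_mset A \<subseteq> Gam f" and size: "n + size A = degree f"
    and inf: "\<And>k. k < n \<Longrightarrow> s (int k) = 0"
    and fin: "\<And>\<beta> j. 1 \<le> j \<Longrightarrow> j \<le> count A \<beta> \<Longrightarrow> (inv_shift f \<beta> ^^ j) s 0 = 0"
  shows "s = (\<lambda>_. 0)"
proof -
  let ?P = "\<Prod>x\<in>#A. [:- x, 1 :: 'a:]"
  have P0: "?P \<noteq> 0" by auto
  obtain e where e: "e \<in> G f" "poly_shift ?P e = s"
    using poly_shift_prod_linear_surj[OF A \<open>s \<in> G f\<close>] by blast
  have "h \<in> {h. poly_shift h e 0 = 0}" if "degree h < n + size A" for h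
  proof (rule partial_fractions_span[OF _ _ _ _ _ that])
    fix k assume "k < n"
    then show "monom 1 k * ?P \<in> {h. poly_shift h e 0 = 0}"
      using inf by (simp add: poly_shift_mult poly_shift_monom e(2))
  next
    fix \<beta> Q and j :: nat assume j: "0 < j" and Q: "Q * [:- \<beta>, 1:] ^ j = ?P"
    \<comment> \<open>The multiplicity of \<open>\<beta>\<close> as a root of \<open>?P\<close>
      bounds \<open>j\<close>, so the \<open>j\<close>-th column of the block is among those assumed
      to vanish.\<close>
    have "[:- \<beta>, 1:] ^ j dvd ?P" unfolding Q[symmetric] by simp
    then have jA: "j \<le> count A \<beta>" using P0 order_prod_linear[of \<beta> A] by (metis order_divides)
    then have "\<beta> \<in># A" using j by (intro count_inI) simp
    then have "\<beta> \<in> Gam f" using A by auto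
    have "s = poly_shift ([:- \<beta>, 1:] ^ j) (poly_shift Q e)"
      using e(2) by (simp only: Q[symmetric] mult.commute poly_shift_mult[symmetric])
    then have "poly_shift Q e = (inv_shift f \<beta> ^^ j) s"
      using inv_shift_pow[OF \<open>\<beta> \<in> Gam f\<close> poly_shift_in_G[OF e(1)]] by simp
    then show "Q \<in> {h. poly_shift h e 0 = 0}" using fin[of j \<beta>] j jA by simp
  qed (simp_all add: poly_shift_add poly_shift_smult)
  \<comment> \<open>Applied to the monomials \<open>x^k\<close>, the span result gives the initial
    terms of \<open>e\<close>.\<close>
  then have "e (int k) = 0" if "k < degree f" for k
    using that size poly_shift_monom[of k e 0] by (auto simp: degree_monom_eq)
  then have "e = (\<lambda>_. 0)" using G_eq_zeroI[OF f e(1)] by blast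
  then show ?thesis using e(2) by (simp add: poly_shift_zero_stream)
qed

section \<open>Orbits\<close>

lemma period_props:
  fixes f :: "'a::{field, finite} poly"
  assumes "coeff f 0 \<noteq> 0" "degree f \<ge> 1" "s \<in> G f"
  shows "period s > 0" "(left_shift ^^ period s) s = s"
proof -
  obtain \<rho> where "\<rho> > 0" "f dvd monom 1 \<rho> - 1"
    using monom_finite_order[OF assms(1,2)] .
  then have "\<rho> > 0 \<and> (left_shift ^^ \<rho>) s = s"
    using G_shift_periodic[OF assms(3)] by (simp add: fun_eq_iff left_shift_pow)
  from LeastI[of "\<lambda>\<rho>. \<rho> > 0 \<and> (left_shift ^^ \<rho>) s = s", OF this]
  show "period s > 0" "(left_shift ^^ period s) s = s" by (simp_all add: period_def)
qed

lemma left_shift_pow_mult_fixed: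
  assumes "(left_shift ^^ p) s = s"
  shows "(left_shift ^^ (k * p)) s = s"
  by (induction k) (simp_all add: funpow_add assms)

text \<open>Exponents are reduced modulo the period. Without the bound on \<open>i\<close>, orbits
  of different base points are easy to compare.\<close>

lemma stream_orbit_eq_range:
  fixes f :: "'a::{field, finite} poly"
  assumes "coeff f 0 \<noteq> 0" "degree f \<ge> 1" "s \<in> G f"
  shows "stream_orbit s = range (\<lambda>i. (left_shift ^^ i) s)"
proof
  note p = period_props[OF assms]
  show "range (\<lambda>i. (left_shift ^^ i) s) \<subseteq> stream_orbit s"
  proof clarify
    fix i
    have "(left_shift ^^ i) s = (left_shift ^^ (i mod period s + i div period s * period s)) s"
      by (simp only: mod_div_mult_eq)
    also have "\<dots> = (left_shift ^^ (i mod period s)) s"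
      by (simp only: funpow_add o_apply left_shift_pow_mult_fixed[OF p(2)])
    finally show "(left_shift ^^ i) s \<in> stream_orbit s"
      using p(1) by (auto simp: stream_orbit_def intro!: exI[of _ "i mod period s"])
  qed
qed (auto simp: stream_orbit_def)

lemma stream_orbit_in_G:
  assumes "s \<in> G f" "a \<in> stream_orbit s"
  shows "a \<in> G f"
  using assms by (auto simp: stream_orbit_def left_shift_pow_in_G)

lemma stream_orbit_eq:
  fixes f :: "'a::{field, finite} poly"
  assumes f: "coeff f 0 \<noteq> 0" "degree f \<ge> 1" and s: "s \<in> G f" and "a \<in> stream_orbit s"
  shows "stream_orbit a = stream_orbit s"
proof -
  have a: "a \<in> G f" using stream_orbit_in_G[OF s] assms(4) .
  obtain i where i: "i < period s" "a = (left_shift ^^ i) s"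
    using assms(4) by (auto simp: stream_orbit_def)
  \<comment> \<open>Completing the period leads from \<open>a\<close> back to \<open>s\<close> by
    forward shifts only.\<close>
  have "s = (left_shift ^^ (period s - i)) a"
    using i period_props(2)[OF f s] unfolding i(2) funpow_add[THEN fun_cong, unfolded o_apply, symmetric]
    by simp
  then have sub: "(left_shift ^^ k) s = (left_shift ^^ (k + (period s - i))) a" for k
    by (simp add: funpow_add)
  have "(left_shift ^^ k) a = (left_shift ^^ (k + i)) s" for k
    by (simp add: funpow_add i(2))
  then show ?thesis
    unfolding stream_orbit_eq_range[OF f s] stream_orbit_eq_range[OF f a] using sub by blast
qed

text \<open>Lists the orbit in the order of the rows of its block row.\<close>

definition orbit_list :: "'a stream \<Rightarrow> 'a stream list" where
  "orbit_list a = map (\<lambda>r. (left_shift ^^ r) a) [0..<period a]"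

lemma set_orbit_list: "set (orbit_list a) = stream_orbit a"
  by (auto simp: orbit_list_def stream_orbit_def)

lemma distinct_orbit_list: "distinct (orbit_list a)"
proof -
  have False if "i < j" "j < period a" "(left_shift ^^ i) a = (left_shift ^^ j) a" for i j
  proof -
    \<comment> \<open>Two equal shifts would give the positive period \<open>j - i\<close>, below
      the least one. The common shift by \<open>i\<close> is cancelled by evaluating at
      \<open>n - int i\<close>, which the two-sided indexing permits.\<close>
    have "(left_shift ^^ (j - i)) a n = a n" for n
    proof -
      have "(left_shift ^^ (j - i)) a n = a (n - int i + int j)"
        using that(1) by (simp add: left_shift_pow of_nat_diff add_diff_eq diff_add_eq)
      also have "\<dots> = (left_shift ^^ i) a (n - int i)"
        unfolding that(3) by (rule left_shift_pow[symmetric])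
      finally show ?thesis by (simp add: left_shift_pow)
    qed
    then have "0 < j - i \<and> (left_shift ^^ (j - i)) a = a"
      using that(1) by (intro conjI ext) simp_all
    from Least_le[of "\<lambda>\<rho>. \<rho> > 0 \<and> (left_shift ^^ \<rho>) a = a", OF this]
    have "period a \<le> j - i" by (simp add: period_def)
    then show False using that by simp
  qed
  then have "inj_on (\<lambda>r. (left_shift ^^ r) a) {..<period a}"
    by (intro linorder_inj_onI) auto
  then show ?thesis by (simp add: orbit_list_def distinct_map atLeast0LessThan)
qed

lemma orbit_lists_enumerate_G:
  fixes f :: "'a::{field, finite} poly"
  assumes f: "coeff f 0 \<noteq> 0" "degree f \<ge> 1"
    and orbits: "distinct orbits" "set orbits = stream_orbit ` G f" "list_all2 (\<in>) bases orbits"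
  shows "distinct (concat (map orbit_list bases))"
    and "set (concat (map orbit_list bases)) = G f"
proof -
  have "stream_orbit (bases ! i) = orbits ! i" if "i < length bases" for i
  proof -
    have "bases ! i \<in> orbits ! i" "orbits ! i \<in> set orbits"
      using orbits(3) that by (auto simp: list_all2_conv_all_nth)
    then obtain s where "s \<in> G f" "orbits ! i = stream_orbit s" using orbits(2) by auto
    then show ?thesis using stream_orbit_eq[OF f] \<open>bases ! i \<in> orbits ! i\<close> by metis
  qed
  then have eq: "map stream_orbit bases = orbits"
    using orbits(3) by (intro nth_equalityI) (auto simp: list_all2_conv_all_nth)
  have in_G: "a \<in> G f" if "a \<in> set bases" for a
  proof -
    obtain i where i: "i < length bases" "bases ! i = a" using \<open>a \<in> set bases\<close> by (metis in_set_conv_nth)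
    then have "a \<in> orbits ! i" "orbits ! i \<in> set orbits"
      using orbits(3) by (auto simp: list_all2_conv_all_nth)
    then obtain s where "s \<in> G f" "a \<in> stream_orbit s" using orbits(2) by auto
    then show ?thesis by (rule stream_orbit_in_G)
  qed
  \<comment> \<open>The lists have the pairwise distinct orbits as their underlying sets, hence are
    themselves distinct.\<close>
  have "map set (map orbit_list bases) = orbits" using eq by (simp add: set_orbit_list comp_def)
  then have "distinct (map orbit_list bases)"
    using orbits(1) distinct_map[of set "map orbit_list bases"] by simp
  moreover have "set ys \<inter> set zs = {}"
    if yz: "ys \<in> set (map orbit_list bases)" "zs \<in> set (map orbit_list bases)" "ys \<noteq> zs" for ys zs
  proof (rule ccontr)
    assume "set ys \<inter> set zs \<noteq> {}"
    moreover obtain a b where ab: "a \<in> set bases" "ys = orbit_list a" "b \<in> set bases" "zs = orbit_list b"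
      using yz(1,2) unfolding set_map by blast
    ultimately obtain x where "x \<in> stream_orbit a" "x \<in> stream_orbit b" by (auto simp: set_orbit_list)
    then have "stream_orbit a = stream_orbit b"
      using stream_orbit_eq[OF f in_G[OF ab(1)]] stream_orbit_eq[OF f in_G[OF ab(3)]] by metis
    moreover have "inj_on stream_orbit (set bases)"
      using eq orbits(1) distinct_map[of stream_orbit bases] by simp
    ultimately have "a = b" using ab(1,3) by (simp add: inj_on_eq_iff)
    then show False using ab(2,4) yz(3) by simp
  qed
  ultimately show "distinct (concat (map orbit_list bases))"
    using distinct_orbit_list by (intro distinct_concat) auto
  have "set (concat (map orbit_list bases)) = \<Union> (set orbits)"
    by (auto simp: set_orbit_list eq[symmetric])
  also have "\<dots> = G f"
  proof
    show "G f \<subseteq> \<Union> (set orbits)"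
    proof
      fix s assume s: "s \<in> G f"
      have "s \<in> stream_orbit s" unfolding stream_orbit_eq_range[OF f s]
        by (rule range_eqI[of _ _ 0]) simp
      then show "s \<in> \<Union> (set orbits)" using s orbits(2) by auto
    qed
  qed (use orbits(2) stream_orbit_in_G in auto)
  finally show "set (concat (map orbit_list bases)) = G f" .
qed

section \<open>The array\<close>

text \<open>Index 0 of every column stream started from \<open>s\<close>; \<open>L^(j-1)\<close> at
  0 gives \<open>s (int (j - 1))\<close>. Rows of the array thereby become indexed by streams
  instead of by pairs of a base and a row number.\<close>

definition stream_row :: "'a::field poly \<Rightarrow> 'a list \<Rightarrow> 'a stream \<Rightarrow> nat \<times> nat \<Rightarrow> 'a" where
  "stream_row f \<beta>s s = (\<lambda>(i, j) \<in> col_labels (length \<beta>s + 1) (degree f).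
     if i = 1 then s (int (j - 1)) else (inv_shift f (\<beta>s ! (i - 2)) ^^ j) s 0)"

lemma M_eq: "M f \<beta>s bases = map (stream_row f \<beta>s) (concat (map orbit_list bases))"
proof -
  have "block_row f \<beta>s a = map (stream_row f \<beta>s) (orbit_list a)" for a
    by (auto simp: block_row_def orbit_list_def stream_row_def M_infinity_def M_beta_def
        inv_shift_pow_left_shift left_shift_pow add.commute intro!: restrict_ext)
  then have "block_row f \<beta>s = map (stream_row f \<beta>s) \<circ> orbit_list" by auto
  then show ?thesis by (simp add: M_def map_concat)
qed

lemma initial_segment:
  fixes J :: "nat set"
  assumes "J \<subseteq> {1..s}" "\<And>j. j \<in> J \<Longrightarrow> j > 1 \<Longrightarrow> j - 1 \<in> J"
  shows "J = {1..card J}"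
proof (cases "J = {}")
  case False
  have fin: "finite J" using assms(1) finite_subset by blast
  \<comment> \<open>Downward induction from the maximum, each step being closure under
    predecessors.\<close>
  have "j \<in> J" if "1 \<le> j" "j \<le> Max J" for j
    using that(2,1)
  proof (induction rule: inc_induct)
    case (step n)
    then show ?case using assms(2)[of "Suc n"] by simp
  qed (use fin False in simp)
  then have "J = {1..Max J}" using assms(1) fin by (auto dest: Max_ge)
  then show ?thesis by (metis card_atLeastAtMost diff_Suc_1)
qed simp

lemma stream_row_inj:
  fixes f :: "'a::{field, finite} poly"
  assumes f: "coeff f 0 \<noteq> 0" "degree f \<ge> 1"
    and \<beta>s: "distinct \<beta>s" "set \<beta>s = Gam f"
    and \<Omega>: "\<Omega> \<subseteq> col_labels (length \<beta>s + 1) (degree f)" "left_justified \<Omega>" "card \<Omega> = degree f"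
  shows "inj_on (\<lambda>s. restrict (stream_row f \<beta>s s) \<Omega>) (G f)"
proof (rule inj_onI)
  fix s s' assume s: "s \<in> G f" "s' \<in> G f"
    and "restrict (stream_row f \<beta>s s) \<Omega> = restrict (stream_row f \<beta>s s') \<Omega>"
  then have eq: "stream_row f \<beta>s s x = stream_row f \<beta>s s' x" if "x \<in> \<Omega>" for x
    using that by (metis restrict_apply')
  define J where "J i = {j. (i, j) \<in> \<Omega>}" for i
  define c where "c i = card (J i)" for i
  have J: "J i = {1..c i}" for i
    unfolding c_def
  proof (rule initial_segment)
    show "J i \<subseteq> {1..degree f}" using \<Omega>(1) by (auto simp: J_def col_labels_def)
    show "j - 1 \<in> J i" if "j \<in> J i" "j > 1" for j
      using that \<Omega>(2) by (auto simp: J_def left_justified_def)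
  qed
  have \<Omega>_iff: "(i, j) \<in> \<Omega> \<longleftrightarrow> 1 \<le> j \<and> j \<le> c i" for i j
    using J[of i] by (auto simp: J_def)
  \<comment> \<open>Block \<open>l + 2\<close> is \<open>Bl(\<beta>s ! l)\<close>, since block 1 is
    \<open>Bl(\<infinity>)\<close> and list positions start at 0.\<close>
  define A where "A = (\<Sum>l<length \<beta>s. replicate_mset (c (l + 2)) (\<beta>s ! l))"
  have "\<Omega> = Sigma {1..length \<beta>s + 1} J"
    using \<Omega>(1) by (auto simp: J_def col_labels_def)
  then have "card \<Omega> = (\<Sum>i\<in>{1..length \<beta>s + 1}. c i)"
    by (simp add: J card_SigmaI)
  also have "\<dots> = c 1 + (\<Sum>l<length \<beta>s. c (l + 2))"
    by (simp only: sum.atLeast1_atMost_eq sum.lessThan_Suc_shift add_2_eq_Suc'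
          One_nat_def add_Suc_right add_0_right)
  finally have "c 1 + size A = degree f" by (simp add: A_def size_multiset_sum \<Omega>(3))
  have count: "count A (\<beta>s ! l) = c (l + 2)" if "l < length \<beta>s" for l
  proof -
    \<comment> \<open>As \<open>\<beta>s\<close> is distinct, only the summand of block
      \<open>l + 2\<close> contains \<open>\<beta>s ! l\<close>.\<close>
    have "count A (\<beta>s ! l) = (\<Sum>k<length \<beta>s. if k = l then c (k + 2) else 0)"
      unfolding A_def count_sum using that \<beta>s(1)
      by (intro sum.cong) (auto simp: nth_eq_iff_index_eq)
    then show ?thesis using that by simp
  qed
  have A: "\<exists>l<length \<beta>s. \<beta> = \<beta>s ! l" if "\<beta> \<in># A" for \<beta>
    using that by (auto simp: A_def set_mset_sum split: if_splits)
  have "(\<lambda>n. s n - s' n) = (\<lambda>_. 0)"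
  proof (rule G_eq_zero_if_columns_zero[OF f G_diff[OF s] _ \<open>c 1 + size A = degree f\<close>])
    show "set_mset A \<subseteq> Gam f" using A \<beta>s(2) by force
    show "s (int k) - s' (int k) = 0" if "k < c 1" for k
    proof -
      have "(1, k + 1) \<in> \<Omega>" using that by (simp add: \<Omega>_iff)
      moreover from this have "(1, k + 1) \<in> col_labels (length \<beta>s + 1) (degree f)" using \<Omega>(1) by blast
      ultimately show ?thesis using eq[of "(1, k + 1)"] by (simp add: stream_row_def)
    qed
    show "(inv_shift f \<beta> ^^ j) (\<lambda>n. s n - s' n) 0 = 0" if "1 \<le> j" "j \<le> count A \<beta>" for \<beta> j
    proof -
      have "\<beta> \<in># A" using that by (intro count_inI) simp
      then obtain l where l: "l < length \<beta>s" "\<beta> = \<beta>s ! l" using A by blast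
      then have "(l + 2, j) \<in> \<Omega>" using that count by (simp add: \<Omega>_iff)
      moreover from this have "(l + 2, j) \<in> col_labels (length \<beta>s + 1) (degree f)" using \<Omega>(1) by blast
      ultimately show ?thesis
        using eq[of "(l + 2, j)"] l(2) by (simp add: stream_row_def inv_shift_pow_diff)
    qed
  qed
  then show "s = s'" by (simp add: fun_eq_iff)
qed

theorem theorem2:
  fixes f :: "'a::{field, finite} poly"
    and q t :: nat
    and \<beta>s :: "'a list"
    and orbits :: "'a stream set list"
    and bases :: "'a stream list"
  assumes "CARD('a) = q"
    and "t \<ge> 1"
    and "degree f = t"
    and "lead_coeff f = 1"
    and "coeff f 0 \<noteq> 0"
    and "distinct \<beta>s" and "set \<beta>s = Gam f"
    and "distinct orbits" and "set orbits = stream_orbit ` G f"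
    and "list_all2 (\<in>) bases orbits"
  shows "is_OOA UNIV (M f \<beta>s bases) (q ^ t) t (card (Gam f) + 1) t q"
proof -
  have f: "coeff f 0 \<noteq> 0" "degree f \<ge> 1" using assms by auto
  define S where "S = concat (map orbit_list bases)"
  have S: "distinct S" "set S = G f"
    unfolding S_def using orbit_lists_enumerate_G[OF f assms(8-10)] by blast+
  have M: "M f \<beta>s bases = map (stream_row f \<beta>s) S" by (simp add: S_def M_eq)
  have len: "card (Gam f) = length \<beta>s" using assms(6,7) distinct_card by metis
  have cardG: "card (G f) = q ^ t" using card_G[OF f] assms(1,3) by simp
  then have lenS: "length S = q ^ t" using S distinct_card by metis
  have "covered UNIV (map (stream_row f \<beta>s) S) \<Omega>"
    if \<Omega>: "\<Omega> \<subseteq> col_labels (length \<beta>s + 1) t" "left_justified \<Omega>" "card \<Omega> = t" for \<Omega>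
    unfolding covered_def
  proof
    fix x assume x: "x \<in> \<Omega> \<rightarrow>\<^sub>E (UNIV :: 'a set)"
    let ?R = "\<lambda>s. restrict (stream_row f \<beta>s s) \<Omega>"
    have inj: "inj_on ?R (G f)"
      using \<Omega> unfolding assms(3)[symmetric] by (rule stream_row_inj[OF f assms(6,7)])
    have "finite \<Omega>" using \<Omega>(1) by (rule finite_subset) (simp add: col_labels_def)
    \<comment> \<open>There are as many tuples as streams, so the injective map from streams to
      tuples is onto.\<close>
    then have "finite (\<Omega> \<rightarrow>\<^sub>E (UNIV :: 'a set))" "card (\<Omega> \<rightarrow>\<^sub>E (UNIV :: 'a set)) = q ^ t"
      using \<Omega>(3) assms(1) by (auto simp: card_PiE intro: finite_PiE)
    moreover have "?R ` G f \<subseteq> \<Omega> \<rightarrow>\<^sub>E UNIV" by (intro image_subsetI) simp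
    ultimately have "?R ` G f = \<Omega> \<rightarrow>\<^sub>E UNIV"
      by (intro card_subset_eq) (simp_all only: card_image[OF inj] cardG)
    then have "x \<in> ?R ` G f" using x by (simp only:)
    then obtain s where s: "s \<in> G f" "?R s = x" by blast
    then obtain r where r: "r < length S" "S ! r = s" using S(2) by (metis in_set_conv_nth)
    show "\<exists>!r. r < length (map (stream_row f \<beta>s) S) \<and> restrict (map (stream_row f \<beta>s) S ! r) \<Omega> = x"
    proof (rule ex1I[of _ r])
      fix r' assume r': "r' < length (map (stream_row f \<beta>s) S) \<and> restrict (map (stream_row f \<beta>s) S ! r') \<Omega> = x"
      \<comment> \<open>Injectivity on \<open>G f\<close> identifies the streams, and distinctness
        of \<open>S\<close> then identifies their row numbers.\<close>
      then have "?R (S ! r') = ?R s" "S ! r' \<in> G f" using s(2) S(2) nth_mem by auto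
      then have "S ! r' = S ! r" using inj_onD[OF inj] s(1) r(2) by simp
      then show "r' = r" using S(1) r(1) r' by (simp add: nth_eq_iff_index_eq)
    qed (use r s in simp)
  qed
  moreover have "set (map (stream_row f \<beta>s) S) \<subseteq> col_labels (length \<beta>s + 1) t \<rightarrow>\<^sub>E UNIV"
    by (auto simp: stream_row_def assms(3))
  ultimately show ?thesis
    unfolding is_OOA_def M len using assms(1) lenS by simp
qed

end
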